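(* Let $f:\mathbb{R}^n\to\mathbb{R}^n$ be a function, $F:\mathbb{R}^n\rightrightarrows\mathbb{R}^n$ a set-valued map with closed graph, and $p:[0,1]\to\mathbb{R}^n$ a continuous function. For $t\in[0,1]$ put $G_t(v)=f(v)-p(t)+F(v)$ and $S(t)=\{z\in\mathbb{R}^n : 0\in G_t(z)\}$. Assume that $z:[0,1]\to\mathbb{R}^n$ is a given continuous solution trajectory for $S$ (that is, $z$ is continuous and $z(t)\in S(t)$ for all $t\in[0,1]$), and that for every $t\in[0,1]$, $G_t$ is strongly metrically regular at $z(t)$ for $0$. Then there exist constants $a,b,\kappa>0$, not depending on $t$, such that for every $t\in[0,1]$ the mapping $\mathbb{B}_b(0)\ni y\mapsto G_t^{-1}(y)\cap\mathbb{B}_a(z(t))$ is single-valued and Lipschitz continuous with constant $\kappa$, and such that the following holds: whenever $0<\epsilon<b/4$ and $\tilde p:[0,1]\to\mathbb{R}^n$ is a continuous function with $\|\tilde p(t)-p(t)\|<\epsilon$ for every $t\in[0,1]$, there exists a continuous solution trajectory $\tilde z:[0,1]\to\mathbb{R}^n$ for $$\widetilde S(t)=\{v\in\mathbb{R}^n : f(v)-\tilde p(t)+F(v)\ni 0\}$$ (that is, $\tilde z$ is continuous and $\tilde z(t)\in\widetilde S(t)$ for all $t\in[0,1]$) such that $$\|\tilde z(t)-z(t)\|<\frac{4a\epsilon}{b}\qquad\text{for every }t\in[0,1].$$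
   Context: $\mathbb{B}_r(x)$ denotes the closed Euclidean ball of radius $r$ around $x$, and $\|\cdot\|$ is the Euclidean norm. "Single-valued" means having exactly one element for each point of the indicated domain. $G_t$ is strongly metrically regular at $z(t)$ for $0$ if $0\in G_t(z(t))$ and there exist constants $a_t,b_t,\kappa_t>0$ (possibly depending on $t$) such that the mapping $\mathbb{B}_{b_t}(0)\ni y\mapsto G_t^{-1}(y)\cap\mathbb{B}_{a_t}(z(t))$ is single-valued and Lipschitz continuous with Lipschitz constant $\kappa_t$. *)

theory Defs
  imports "HOL-Analysis.Analysis"
begin

definition graph_of :: "('a \<Rightarrow> 'b set) \<Rightarrow> ('a \<times> 'b) set" where
  "graph_of F = {(x, y). y \<in> F x}"

definition set_valued_inverse :: "('a \<Rightarrow> 'b set) \<Rightarrow> 'b \<Rightarrow> 'a set" where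
  "set_valued_inverse G y = {x. y \<in> G x}"

definition single_valued_on :: "'a set \<Rightarrow> ('a \<Rightarrow> 'b set) \<Rightarrow> bool" where
  "single_valued_on D M \<longleftrightarrow> (\<forall>y\<in>D. is_singleton (M y))"

text \<open>Lipschitz continuity of a single-valued map refers to the function picking its unique value;
  \<open>the_elem\<close> is meaningful here because of the first conjunct.\<close>

definition single_valued_lipschitz_on ::
    "real \<Rightarrow> 'a::metric_space set \<Rightarrow> ('a \<Rightarrow> 'b::metric_space set) \<Rightarrow> bool" where
  "single_valued_lipschitz_on \<kappa> D M \<longleftrightarrow>
     single_valued_on D M \<and> \<kappa>-lipschitz_on D (\<lambda>y. the_elem (M y))"

definition inverse_localization ::
    "('a::metric_space \<Rightarrow> 'b set) \<Rightarrow> real \<Rightarrow> 'a \<Rightarrow> 'b \<Rightarrow> 'a set" where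
  "inverse_localization G a x y = set_valued_inverse G y \<inter> cball x a"

definition strongly_metrically_regular ::
    "('a::metric_space \<Rightarrow> 'b::metric_space set) \<Rightarrow> 'a \<Rightarrow> 'b \<Rightarrow> bool" where
  "strongly_metrically_regular G x y \<longleftrightarrow> y \<in> G x \<and>
     (\<exists>a>0. \<exists>b>0. \<exists>\<kappa>>0.
        single_valued_lipschitz_on \<kappa> (cball y b) (inverse_localization G a x))"

definition gen_map ::
    "('a \<Rightarrow> 'b::real_normed_vector) \<Rightarrow> ('a \<Rightarrow> 'b set) \<Rightarrow> (real \<Rightarrow> 'b) \<Rightarrow> real \<Rightarrow> 'a \<Rightarrow> 'b set" where
  "gen_map f F p t v = {f v - p t + w | w. w \<in> F v}"

definition sol_map ::
    "('a \<Rightarrow> 'b::real_normed_vector) \<Rightarrow> ('a \<Rightarrow> 'b set) \<Rightarrow> (real \<Rightarrow> 'b) \<Rightarrow> real \<Rightarrow> 'a set" where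
  "sol_map f F p t = {v. 0 \<in> gen_map f F p t v}"

text \<open>Trajectories on the unit interval are total functions whose values outside it are
  irrelevant.\<close>

definition continuous_solution_trajectory ::
    "(real \<Rightarrow> 'a::topological_space set) \<Rightarrow> (real \<Rightarrow> 'a) \<Rightarrow> bool" where
  "continuous_solution_trajectory S z \<longleftrightarrow>
     continuous_on {0..1} z \<and> (\<forall>t\<in>{0..1}. z t \<in> S t)"

end

theory Submission
  imports Defs
begin

text \<open>Writing \<open>H v = f v + F v\<close>, the inverse of \<open>G\<^sub>t\<close> at \<open>y\<close> is the inverse of \<open>H\<close> at \<open>y + p t\<close>, so a
  localization at \<open>t\<close> also serves nearby times \<open>s\<close>: it is only shifted by \<open>p s - p t\<close>, and by
  uniqueness its value at \<open>p s - p t\<close> must be \<open>z s\<close>. Shrinking \<open>b\<close> until \<open>\<kappa> * b \<le> a\<close> keeps its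
  values in the ball of radius \<open>a\<close> around \<open>z s\<close>, and compactness of the interval makes the constants uniform.
  The perturbed trajectory picks the value of the localization at \<open>q t - p t\<close>. It stays
  within \<open>\<kappa> * \<epsilon>\<close>, hence well inside the ball around \<open>z t\<close>, so for \<open>s\<close> near \<open>t\<close> its value at \<open>s\<close> is
  also given by the Lipschitz localization at \<open>t\<close>, which yields continuity.\<close>

section \<open>Single-valued Lipschitz maps and membership criteria\<close>

text \<open>Taking \<open>y = y'\<close> in the estimate forces two members of the same value to
  have distance 0, so nonempty values are singletons. This form removes \<open>the_elem\<close>: the
  estimate applies to any points known to belong to the values.\<close>

lemma single_valued_lipschitz_on_iff:
  "single_valued_lipschitz_on \<kappa> D M \<longleftrightarrow>
     0 \<le> \<kappa> \<and> (\<forall>y\<in>D. M y \<noteq> {}) \<and>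
     (\<forall>y\<in>D. \<forall>y'\<in>D. \<forall>x\<in>M y. \<forall>x'\<in>M y'. dist x x' \<le> \<kappa> * dist y y')"
  (is "?L \<longleftrightarrow> ?R")
proof
  assume L: ?L
  have sing: "M y = {the_elem (M y)}" if "y \<in> D" for y
    using L that by (auto simp: single_valued_lipschitz_on_def single_valued_on_def is_singleton_the_elem)
  have lip: "\<kappa>-lipschitz_on D (\<lambda>y. the_elem (M y))"
    using L by (simp add: single_valued_lipschitz_on_def)
  have "dist x x' \<le> \<kappa> * dist y y'"
    if "y \<in> D" "y' \<in> D" "x \<in> M y" "x' \<in> M y'" for x x' y y'
  proof -
    have "x = the_elem (M y)" "x' = the_elem (M y')"
      using that sing by blast+
    then show ?thesis
      using lipschitz_onD[OF lip that(1,2)] by simp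
  qed
  then show ?R
    using sing lipschitz_on_nonneg[OF lip] by blast
next
  assume R: ?R
  have sing: "is_singleton (M y)" if y: "y \<in> D" for y
  proof -
    obtain x where x: "x \<in> M y" using R y by blast
    have "x' = x" if x': "x' \<in> M y" for x'
    proof -
      have "dist x' x \<le> \<kappa> * dist y y"
        using R y x x' by blast
      then show ?thesis by simp
    qed
    with x have "M y = {x}" by blast
    then show ?thesis by (simp add: is_singleton_def)
  qed
  have "the_elem (M y) \<in> M y" if "y \<in> D" for y
    using sing[OF that] by (metis is_singleton_the_elem insertI1)
  then have "\<kappa>-lipschitz_on D (\<lambda>y. the_elem (M y))"
    using R by (intro lipschitz_onI) auto
  with sing show ?L
    by (simp add: single_valued_lipschitz_on_def single_valued_on_def)
qed

lemma mem_gen_map_iff: "y \<in> gen_map f F p t v \<longleftrightarrow> y + p t - f v \<in> F v"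
proof
  assume "y + p t - f v \<in> F v"
  then show "y \<in> gen_map f F p t v"
    unfolding gen_map_def by (auto intro!: exI[of _ "y + p t - f v"])
qed (auto simp: gen_map_def)

lemma mem_sol_map_iff: "v \<in> sol_map f F p t \<longleftrightarrow> p t - f v \<in> F v"
  by (simp add: sol_map_def mem_gen_map_iff)

text \<open>Only the sum \<open>y + p t\<close> enters the inclusion, so a change of time can be
  compensated by a shift of \<open>y\<close>.\<close>

lemma mem_inverse_localization_gen_map_iff:
  "v \<in> inverse_localization (gen_map f F p t) a x y \<longleftrightarrow>
     y + p t - f v \<in> F v \<and> dist x v \<le> a"
  by (auto simp: inverse_localization_def set_valued_inverse_def mem_gen_map_iff)

section \<open>Transfer of a localization to nearby times\<close>

lemma single_valued_lipschitz_on_nearby: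
  fixes f :: "'a::metric_space \<Rightarrow> 'b::real_normed_vector"
  assumes loc: "single_valued_lipschitz_on \<kappa>' (cball 0 b') (inverse_localization (gen_map f F p t) a' x)"
    and x': "x' \<in> sol_map f F p s"
    and "dist x x' \<le> a' - a" "dist (p t) (p s) \<le> b' - b"
    and "\<kappa>' \<le> \<kappa>" "0 \<le> a" "0 \<le> b" "\<kappa> * b \<le> a"
  shows "single_valued_lipschitz_on \<kappa> (cball 0 b) (inverse_localization (gen_map f F p s) a x')"
proof -
  let ?M = "inverse_localization (gen_map f F p t) a' x"
  let ?N = "inverse_localization (gen_map f F p s) a x'"
  \<comment> \<open>Since \<open>?h y + p t = y + p s\<close>, the inverse at time \<open>t\<close>
    of \<open>?h y\<close> is the inverse at time \<open>s\<close> of \<open>y\<close>.\<close>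
  let ?h = "\<lambda>y. y + p s - p t"
  have \<kappa>': "0 \<le> \<kappa>'"
    and ne: "\<And>y. norm y \<le> b' \<Longrightarrow> ?M y \<noteq> {}"
    and lip: "\<And>y y' v v'. \<lbrakk>norm y \<le> b'; norm y' \<le> b'; v \<in> ?M y; v' \<in> ?M y'\<rbrakk>
        \<Longrightarrow> dist v v' \<le> \<kappa>' * dist y y'"
    using loc by (auto simp: single_valued_lipschitz_on_iff)
  have shift: "norm (?h y) \<le> b'" if "norm y \<le> b" for y
    using that assms(4) norm_triangle_ineq[of y "p s - p t"]
    by (simp add: dist_norm norm_minus_commute add_diff_eq)
  have sub: "v \<in> ?M (?h y)" if "v \<in> ?N y" for v y
    using that assms(3) dist_triangle[of x v x']
    by (auto simp: mem_inverse_localization_gen_map_iff)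
  have lip': "dist v v' \<le> \<kappa> * dist y y'"
    if "norm y \<le> b" "norm y' \<le> b" "v \<in> ?M (?h y)" "v' \<in> ?M (?h y')" for y y' v v'
  proof -
    have "dist v v' \<le> \<kappa>' * dist (?h y) (?h y')"
      using that by (intro lip shift)
    also have "dist (?h y) (?h y') = dist y y'"
      by (simp add: dist_norm)
    also have "\<kappa>' * dist y y' \<le> \<kappa> * dist y y'"
      using assms(5) by (intro mult_right_mono) auto
    finally show ?thesis .
  qed
  \<comment> \<open>Here \<open>?h 0 + p t = p s\<close>. This anchors the Lipschitz estimate at
    \<open>x'\<close>: the value at \<open>?h y\<close> lies within
    \<open>\<kappa> * b \<le> a\<close> of \<open>x'\<close>, which gives nonemptiness in the
    smaller ball.\<close>
  have x'M: "x' \<in> ?M (?h 0)"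
    using x' assms(3,6) by (auto simp: mem_inverse_localization_gen_map_iff mem_sol_map_iff)
  have "?N y \<noteq> {}" if y: "norm y \<le> b" for y
  proof -
    obtain v where v: "v \<in> ?M (?h y)"
      using ne[OF shift[OF y]] by blast
    have "dist x' v \<le> \<kappa> * norm y"
      using lip'[OF _ y x'M v] assms(7) by simp
    also have "\<dots> \<le> \<kappa> * b"
      using y \<kappa>' assms(5) by (intro mult_left_mono) auto
    finally have "v \<in> ?N y"
      using v assms(8) by (auto simp: mem_inverse_localization_gen_map_iff)
    then show ?thesis by blast
  qed
  then show ?thesis
    using \<kappa>' assms(5) by (auto simp: single_valued_lipschitz_on_iff intro!: lip' sub)
qed

section \<open>Uniform constants by compactness\<close>

text \<open>The property survives decreasing \<open>m\<close>, so the minimum of the constants of a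
  finite subcover works everywhere. The filter ignores the point \<open>x\<close> itself, hence the
  separate hypothesis there.\<close>

lemma compact_uniform_positive:
  fixes P :: "real \<Rightarrow> 'a::topological_space \<Rightarrow> bool"
  assumes "compact K"
    and antimono: "\<And>m m' x. \<lbrakk>P m x; 0 < m'; m' \<le> m\<rbrakk> \<Longrightarrow> P m' x"
    and "\<And>x. x \<in> K \<Longrightarrow> \<exists>m>0. \<forall>\<^sub>F y in at x within K. P m y"
    and "\<And>x. x \<in> K \<Longrightarrow> \<exists>m>0. P m x"
  shows "\<exists>m>0. \<forall>x\<in>K. P m x"
proof -
  have "\<exists>m U. 0 < m \<and> open U \<and> x \<in> U \<and> (\<forall>y\<in>U \<inter> K. P m y)" if x: "x \<in> K" for x
  proof -
    obtain m U where m: "0 < m" "open U" "x \<in> U" "\<And>y. \<lbrakk>y \<in> U; y \<noteq> x; y \<in> K\<rbrakk> \<Longrightarrow> P m y"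
      using assms(3)[OF x] unfolding eventually_at_topological by blast
    obtain m' where "0 < m'" "P m' x"
      using assms(4)[OF x] by blast
    with m have "\<forall>y\<in>U \<inter> K. P (min m m') y"
      by (metis antimono IntE min.cobounded1 min.cobounded2 min_less_iff_conj)
    with m \<open>0 < m'\<close> show ?thesis
      by (intro exI[of _ "min m m'"] exI[of _ U]) auto
  qed
  then obtain m U where mU: "\<And>x. x \<in> K \<Longrightarrow> 0 < m x \<and> open (U x) \<and> x \<in> U x \<and> (\<forall>y\<in>U x \<inter> K. P (m x) y)"
    by metis
  then have "\<And>x. x \<in> K \<Longrightarrow> open (U x)" "K \<subseteq> (\<Union>x\<in>K. U x)"
    by auto
  with \<open>compact K\<close> obtain T where T: "T \<subseteq> K" "finite T" "K \<subseteq> (\<Union>x\<in>T. U x)"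
    by (metis compactE_image)
  \<comment> \<open>The inserted 1 keeps the set nonempty when \<open>T\<close> is empty.\<close>
  define \<mu> where "\<mu> = Min (insert 1 (m ` T))"
  have "0 < \<mu>"
    using T mU by (auto simp: \<mu>_def)
  moreover have "P \<mu> y" if y: "y \<in> K" for y
  proof -
    obtain x where x: "x \<in> T" "y \<in> U x"
      using T y by blast
    moreover have "\<mu> \<le> m x"
      using T x by (auto simp: \<mu>_def)
    ultimately show ?thesis
      using antimono[OF _ \<open>0 < \<mu>\<close>] mU T(1) y by blast
  qed
  ultimately show ?thesis by blast
qed

text \<open>The single number \<open>m\<close> bounds \<open>a\<close>, \<open>b\<close> and \<open>1 / \<kappa>\<close> at once.\<close>

lemma uniform_strong_metric_regularity:
  fixes f :: "'a::metric_space \<Rightarrow> 'b::real_normed_vector"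
  assumes "compact K" "continuous_on K p" "continuous_on K z"
    and sol: "\<And>t. t \<in> K \<Longrightarrow> z t \<in> sol_map f F p t"
    and reg: "\<And>t. t \<in> K \<Longrightarrow> strongly_metrically_regular (gen_map f F p t) (z t) 0"
  shows "\<exists>m>0. \<forall>t\<in>K. \<forall>a b \<kappa>.
    0 \<le> a \<longrightarrow> a \<le> m \<longrightarrow> 0 \<le> b \<longrightarrow> b \<le> m \<longrightarrow> 1 / m \<le> \<kappa> \<longrightarrow> \<kappa> * b \<le> a \<longrightarrow>
    single_valued_lipschitz_on \<kappa> (cball 0 b) (inverse_localization (gen_map f F p t) a (z t))"
proof -
  define P where "P m t \<longleftrightarrow> (\<forall>a b \<kappa>.
    0 \<le> a \<longrightarrow> a \<le> m \<longrightarrow> 0 \<le> b \<longrightarrow> b \<le> m \<longrightarrow> 1 / m \<le> \<kappa> \<longrightarrow> \<kappa> * b \<le> a \<longrightarrow>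
    single_valued_lipschitz_on \<kappa> (cball 0 b) (inverse_localization (gen_map f F p t) a (z t)))"
    for m t
  have local: "\<exists>m>0. P m t \<and> (\<forall>\<^sub>F s in at t within K. P m s)" if t: "t \<in> K" for t
  proof -
    obtain a' b' \<kappa>' where pos: "0 < a'" "0 < b'" "0 < \<kappa>'"
      and loc: "single_valued_lipschitz_on \<kappa>' (cball 0 b') (inverse_localization (gen_map f F p t) a' (z t))"
      using reg[OF t] unfolding strongly_metrically_regular_def by blast
    \<comment> \<open>Half of each radius is left for the drift of \<open>z\<close> and of
      \<open>p\<close> near \<open>t\<close>; the term \<open>1 / \<kappa>'\<close> ensures
      \<open>\<kappa>' \<le> 1 / m\<close>.\<close>
    define m where "m = min (min (a' / 2) (b' / 2)) (1 / \<kappa>')"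
    have m: "0 < m" "m \<le> a' / 2" "m \<le> b' / 2" "m \<le> 1 / \<kappa>'"
      using pos by (auto simp: m_def)
    have \<kappa>': "\<kappa>' \<le> 1 / m"
      using m pos by (simp add: field_simps)
    have P: "P m s" if "s \<in> K" "dist (z t) (z s) < a' / 2" "dist (p t) (p s) < b' / 2" for s
      unfolding P_def using that m \<kappa>'
      by (intro allI impI single_valued_lipschitz_on_nearby[OF loc sol]) auto
    have "\<forall>\<^sub>F s in at t within K. dist (z s) (z t) < a' / 2"
      using assms(3) t pos by (intro tendstoD) (auto simp: continuous_on)
    moreover have "\<forall>\<^sub>F s in at t within K. dist (p s) (p t) < b' / 2"
      using assms(2) t pos by (intro tendstoD) (auto simp: continuous_on)
    moreover have "\<forall>\<^sub>F s in at t within K. s \<in> K"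
      by (simp add: eventually_at_filter)
    ultimately have "\<forall>\<^sub>F s in at t within K. P m s"
      by eventually_elim (rule P, auto simp: dist_commute)
    moreover have "P m t"
      using pos t by (intro P) auto
    ultimately show ?thesis
      using m(1) by blast
  qed
  have "\<exists>m>0. \<forall>t\<in>K. P m t"
  proof (rule compact_uniform_positive[OF \<open>compact K\<close>])
    fix m m' :: real and t
    assume "P m t" "0 < m'" "m' \<le> m"
    moreover from this have "1 / m \<le> 1 / m'"
      by (simp add: frac_le)
    ultimately show "P m' t"
      unfolding P_def by fastforce
  qed (use local in blast)+
  then show ?thesis
    unfolding P_def .
qed

section \<open>Construction and continuity of the perturbed trajectory\<close>

lemma perturbed_solution_trajectory:
  fixes f :: "'a::metric_space \<Rightarrow> 'b::real_normed_vector"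
  assumes q: "continuous_on {0..1} q"
    and z: "continuous_solution_trajectory (sol_map f F p) z"
    and loc: "\<And>t. t \<in> {0..1} \<Longrightarrow> single_valued_lipschitz_on \<kappa> (cball 0 b)
      (inverse_localization (gen_map f F p t) a (z t))"
    and close: "\<And>t. t \<in> {0..1} \<Longrightarrow> dist (p t) (q t) < \<epsilon>"
    and "0 < \<epsilon>" "\<epsilon> < b" "\<kappa> * \<epsilon> < a"
  shows "\<exists>w. continuous_solution_trajectory (sol_map f F q) w \<and>
    (\<forall>t\<in>{0..1}. dist (z t) (w t) \<le> \<kappa> * \<epsilon>)"
proof -
  let ?M = "\<lambda>t. inverse_localization (gen_map f F p t) a (z t)"
  have zc: "continuous_on {0..1} z" and zs: "\<And>t. t \<in> {0..1} \<Longrightarrow> z t \<in> sol_map f F p t"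
    using z by (auto simp: continuous_solution_trajectory_def)
  have "0 \<le> \<kappa>"
    using loc[of 0] by (simp add: single_valued_lipschitz_on_iff)
  then have "0 < a"
    using assms(5,7) by (smt (verit) mult_nonneg_nonneg)
  have ne: "\<And>t y. \<lbrakk>t \<in> {0..1}; norm y \<le> b\<rbrakk> \<Longrightarrow> ?M t y \<noteq> {}"
    using loc by (fastforce simp: single_valued_lipschitz_on_iff)
  have lip: "dist v v' \<le> \<kappa> * dist y y'"
    if "t \<in> {0..1}" "norm y \<le> b" "norm y' \<le> b" "v \<in> ?M t y" "v' \<in> ?M t y'" for t y y' v v'
    using loc[OF that(1)] that(2-) by (auto simp: single_valued_lipschitz_on_iff)
  have small: "norm (q t - p t) < \<epsilon>" if "t \<in> {0..1}" for t
    using close[OF that] by (simp add: dist_norm norm_minus_commute)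
  define w where "w t = (SOME v. v \<in> ?M t (q t - p t))" for t
  have w: "w t \<in> ?M t (q t - p t)" if "t \<in> {0..1}" for t
    unfolding w_def some_in_eq using small[OF that] assms(6) by (intro ne that) auto
  have wz: "dist (z t) (w t) \<le> \<kappa> * \<epsilon>" if t: "t \<in> {0..1}" for t
  proof -
    \<comment> \<open>The original trajectory is the value at \<open>0\<close>, so its distance to
      \<open>w t\<close> is controlled by the size of \<open>q t - p t\<close>.\<close>
    have "z t \<in> ?M t 0"
      using zs[OF t] \<open>0 < a\<close> by (simp add: mem_inverse_localization_gen_map_iff mem_sol_map_iff)
    then have "dist (z t) (w t) \<le> \<kappa> * dist 0 (q t - p t)"
      using small[OF t] assms(5,6) by (intro lip[OF t _ _ _ w[OF t]]) auto
    also have "\<dots> \<le> \<kappa> * \<epsilon>"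
      using small[OF t] \<open>0 \<le> \<kappa>\<close> by (intro mult_left_mono) auto
    finally show ?thesis .
  qed
  have "(w \<longlongrightarrow> w t) (at t within {0..1})" if t: "t \<in> {0..1}" for t
  proof -
    have qt: "(q \<longlongrightarrow> q t) (at t within {0..1})"
      using q t by (auto simp: continuous_on)
    \<comment> \<open>The strict inequalities \<open>\<kappa> * \<epsilon> < a\<close> and
      \<open>\<epsilon> < b\<close> leave positive margins, which serve as tolerances for the
      variation of \<open>z\<close> and \<open>q\<close>.\<close>
    have "\<forall>\<^sub>F s in at t within {0..1}. dist (z s) (z t) < a - \<kappa> * \<epsilon>"
      using zc t assms(7) by (intro tendstoD) (auto simp: continuous_on)
    moreover have "\<forall>\<^sub>F s in at t within {0..1}. dist (q s) (q t) < b - \<epsilon>"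
      using assms(6) by (intro tendstoD[OF qt]) auto
    moreover have "\<forall>\<^sub>F s in at t within {0..1}. s \<in> {0..1}"
      by (simp add: eventually_at_filter)
    ultimately have ev: "\<forall>\<^sub>F s in at t within {0..1}. dist (w s) (w t) \<le> \<kappa> * dist (q s) (q t)"
    proof eventually_elim
      case (elim s)
      have "dist (z t) (w s) \<le> a"
        using elim wz[of s] dist_triangle[of "z t" "w s" "z s"] by (simp add: dist_commute)
      \<comment> \<open>Both \<open>q s - p s\<close> at time \<open>s\<close> and
        \<open>q s - p t\<close> at time \<open>t\<close> give the same inclusion, with right-hand
        side \<open>q s\<close>.\<close>
      then have ws: "w s \<in> ?M t (q s - p t)"
        using w[of s] elim by (simp add: mem_inverse_localization_gen_map_iff)
      have "norm (q s - p t) \<le> b"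
        using small[OF t] elim norm_triangle_ineq[of "q s - q t" "q t - p t"]
        by (simp add: dist_norm)
      then have "dist (w s) (w t) \<le> \<kappa> * dist (q s - p t) (q t - p t)"
        using small[OF t] assms(6) by (intro lip[OF t _ _ ws w[OF t]]) auto
      then show ?case
        by (simp add: dist_norm)
    qed
    have "((\<lambda>s. \<kappa> * dist (q s) (q t)) \<longlongrightarrow> \<kappa> * dist (q t) (q t)) (at t within {0..1})"
      by (intro tendsto_intros qt)
    then have lim: "((\<lambda>s. \<kappa> * dist (q s) (q t)) \<longlongrightarrow> 0) (at t within {0..1})"
      by simp
    have "((\<lambda>s. dist (w s) (w t)) \<longlongrightarrow> 0) (at t within {0..1})"
      by (rule tendsto_sandwich[OF _ ev tendsto_const lim]) simp
    then show ?thesis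
      by (rule tendsto_dist_iff[THEN iffD2])
  qed
  then have "continuous_on {0..1} w"
    by (simp add: continuous_on)
  moreover have "w t \<in> sol_map f F q t" if "t \<in> {0..1}" for t
    using w[OF that] by (simp add: mem_inverse_localization_gen_map_iff mem_sol_map_iff)
  ultimately show ?thesis
    using wz by (auto simp: continuous_solution_trajectory_def)
qed

theorem theorem4p11:
  fixes f :: "real ^ 'n \<Rightarrow> real ^ 'n"
    and F :: "real ^ 'n \<Rightarrow> (real ^ 'n) set"
    and p :: "real \<Rightarrow> real ^ 'n"
    and z :: "real \<Rightarrow> real ^ 'n"
  assumes "closed (graph_of F)"
    and "continuous_on {0..1} p"
    and "continuous_solution_trajectory (sol_map f F p) z"
    and "\<forall>t\<in>{0..1}. strongly_metrically_regular (gen_map f F p t) (z t) 0"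
  shows "\<exists>a>0. \<exists>b>0. \<exists>\<kappa>>0.
     (\<forall>t\<in>{0..1}. single_valued_lipschitz_on \<kappa> (cball 0 b)
        (inverse_localization (gen_map f F p t) a (z t))) \<and>
     (\<forall>\<epsilon> q. 0 < \<epsilon> \<and> \<epsilon> < b / 4 \<and> continuous_on {0..1} q \<and>
        (\<forall>t\<in>{0..1}. norm (q t - p t) < \<epsilon>) \<longrightarrow>
        (\<exists>w. continuous_solution_trajectory (sol_map f F q) w \<and>
             (\<forall>t\<in>{0..1}. norm (w t - z t) < 4 * a * \<epsilon> / b)))"
proof -
  have zc: "continuous_on {0..1} z" and zs: "\<And>t. t \<in> {0..1} \<Longrightarrow> z t \<in> sol_map f F p t"
    using assms(3) by (auto simp: continuous_solution_trajectory_def)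
  obtain m where m: "0 < m" and loc: "\<And>t a b \<kappa>.
      \<lbrakk>t \<in> {0..1}; 0 \<le> a; a \<le> m; 0 \<le> b; b \<le> m; 1 / m \<le> \<kappa>; \<kappa> * b \<le> a\<rbrakk> \<Longrightarrow>
      single_valued_lipschitz_on \<kappa> (cball 0 b) (inverse_localization (gen_map f F p t) a (z t))"
    using uniform_strong_metric_regularity[OF compact_Icc assms(2) zc zs] assms(4) by blast
  \<comment> \<open>With radius \<open>m\<close> and Lipschitz constant \<open>1 / m\<close>, the
    bound \<open>b \<le> m * m\<close> is the requirement
    \<open>\<kappa> * b \<le> a\<close>.\<close>
  define b where "b = min m (m * m)"
  have b: "0 < b" "b \<le> m" "1 / m * b \<le> m"
    using m by (auto simp: b_def field_simps)
  have L: "single_valued_lipschitz_on (1 / m) (cball 0 b)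
      (inverse_localization (gen_map f F p t) m (z t))" if "t \<in> {0..1}" for t
    using that m b by (intro loc) auto
  have "\<exists>w. continuous_solution_trajectory (sol_map f F q) w \<and>
      (\<forall>t\<in>{0..1}. norm (w t - z t) < 4 * m * \<epsilon> / b)"
    if *: "0 < \<epsilon> \<and> \<epsilon> < b / 4 \<and> continuous_on {0..1} q \<and>
      (\<forall>t\<in>{0..1}. norm (q t - p t) < \<epsilon>)" for \<epsilon> q
  proof -
    from * have \<epsilon>: "0 < \<epsilon>" "\<epsilon> < b"
      using b by auto
    then have "1 / m * \<epsilon> < 1 / m * b"
      using m by (intro mult_strict_left_mono) auto
    then have "1 / m * \<epsilon> < m"
      using b by linarith
    with * \<epsilon> obtain w where w: "continuous_solution_trajectory (sol_map f F q) w"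
      "\<And>t. t \<in> {0..1} \<Longrightarrow> dist (z t) (w t) \<le> 1 / m * \<epsilon>"
      using perturbed_solution_trajectory[OF _ assms(3) L, of q \<epsilon>]
      by (auto simp: dist_norm norm_minus_commute)
    \<comment> \<open>Dividing \<open>\<kappa> * b \<le> a\<close> by \<open>b\<close> turns the
      bound \<open>\<kappa> * \<epsilon>\<close> into \<open>a * \<epsilon> / b\<close>; the factor
      4 then makes the inequality strict.\<close>
    have "1 / m * \<epsilon> \<le> m * \<epsilon> / b"
      using b \<epsilon> m mult_right_mono[OF b(3), of \<epsilon>] by (simp add: field_simps)
    also have "\<dots> < 4 * m * \<epsilon> / b"
      using b \<epsilon> m by (simp add: field_simps)
    finally have "norm (w t - z t) < 4 * m * \<epsilon> / b" if t: "t \<in> {0..1}" for t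
      using w(2)[OF t] by (simp add: dist_norm norm_minus_commute)
    with w(1) show ?thesis
      by blast
  qed
  with L have "(\<forall>t\<in>{0..1}. single_valued_lipschitz_on (1 / m) (cball 0 b)
      (inverse_localization (gen_map f F p t) m (z t))) \<and>
    (\<forall>\<epsilon> q. 0 < \<epsilon> \<and> \<epsilon> < b / 4 \<and> continuous_on {0..1} q \<and>
      (\<forall>t\<in>{0..1}. norm (q t - p t) < \<epsilon>) \<longrightarrow>
      (\<exists>w. continuous_solution_trajectory (sol_map f F q) w \<and>
        (\<forall>t\<in>{0..1}. norm (w t - z t) < 4 * m * \<epsilon> / b)))"
    by blast
  moreover have "0 < 1 / m"
    using m by simp
  ultimately show ?thesis
    by - (rule exI[of _ m], rule conjI[OF m], rule exI[of _ b], rule conjI[OF b(1)],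
      rule exI[of _ "1 / m"], rule conjI)
qed

end
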